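(* Let $1\le k\le n$ be integers (with $n\le N$ when $J=\{1,\dots,N\}$), and let $$\mathcal{S}_{k,n}=\{\theta\in l_2(J):\ \theta_j=0\ \text{for all } j>n,\ \mathrm{Card}\{j\le n:\theta_j\ne0\}\le k\}.$$ Let $\sigma_{(1)}\le\sigma_{(2)}\le\dots\le\sigma_{(n)}$ be the values $\sigma_1,\dots,\sigma_n$ arranged in non-decreasing order, and for $l\in\{0,\dots,n-k\}$ let $\Sigma_{l,k}^2=\sum_{j=l+1}^{l+k}\sigma_{(j)}^2$. Let $\alpha\in(0,1)$ and $\beta\in(0,1-\alpha)$ be such that $\alpha+\beta\le 0.59$, and let $\rho_{k,n}>0$ be defined by $$\rho_{k,n}^2=\Bigl[\max_{0\le l\le n-k}\Sigma_{l,k}^2\,\ln\Bigl(1+\Bigl(\frac{n-l}{k^2}\vee\sqrt{\frac{n-l}{k^2}}\Bigr)\Bigr)\Bigr]\ \vee\ \Bigl(\sum_{j=n-k+1}^n\sigma_{(j)}^4\Bigr)^{1/2}.$$ Then for every level-$\alpha$ test $\Phi_\alpha$ of "$\theta=0$", $$\inf_{\theta\in\mathcal{S}_{k,n},\ \|\theta\|_2\ge\rho_{k,n}}\mathbb{P}_\theta(\Phi_\alpha=1)\le 1-\beta.$$ Consequently $\rho_2(\mathcal{S}_{k,n},\alpha,\beta)\ge\rho_{k,n}$.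
   Context: Model: $J=\{1,\dots,N\}$ for some integer $N\ge1$, or $J=\{1,2,3,\dots\}$. One observes $Y=(Y_j)_{j\in J}$ with $Y_j=\theta_j+\sigma_j\epsilon_j$, where $\theta=(\theta_j)_{j\in J}$ is unknown, $\sigma_j>0$ are known, and $(\epsilon_j)_{j\in J}$ are i.i.d. standard normal. $\mathbb{P}_\theta$ is the distribution of $Y$. $\|\theta\|_2^2=\sum_{j\in J}\theta_j^2$, and $x\vee y=\max(x,y)$. A test is a measurable function $\Phi$ of $Y$ with values in $\{0,1\}$; the null hypothesis "$\theta=0$" is rejected iff $\Phi=1$. It has level $\alpha$ if $\mathbb{P}_0(\Phi=1)\le\alpha$. For $\mathcal{F}\subset l_2(J)$ and a level-$\alpha$ test $\Phi_\alpha$, $\rho_2(\Phi_\alpha,\mathcal{F},\beta)=\inf\{\rho>0:\ \inf_{\theta\in\mathcal{F},\|\theta\|_2\ge\rho}\mathbb{P}_\theta(\Phi_\alpha=1)>1-\beta\}$, and the $(\alpha,\beta)$ minimax rate of testing $\rho_2(\mathcal{F},\alpha,\beta)$ is the infimum of $\rho_2(\Phi_\alpha,\mathcal{F},\beta)$ over all level-$\alpha$ tests $\Phi_\alpha$. *)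

theory Defs
  imports "HOL-Probability.Probability"
begin

text \<open>
  A sequence indexed by \<open>J\<close> is a function \<open>nat \<Rightarrow> real\<close> in \<open>extensional J\<close>, in agreement
  with the points of the product space \<open>PiM J (\<lambda>_. borel)\<close>.
\<close>

definition l2 :: "nat set \<Rightarrow> (nat \<Rightarrow> real) set" where
  "l2 J = {\<theta> \<in> extensional J. (\<lambda>j. (\<theta> j)\<^sup>2) summable_on J}"

definition l2_norm :: "nat set \<Rightarrow> (nat \<Rightarrow> real) \<Rightarrow> real" where
  "l2_norm J \<theta> = sqrt (\<Sum>\<^sub>\<infinity>j\<in>J. (\<theta> j)\<^sup>2)"

definition noise :: "nat set \<Rightarrow> (nat \<Rightarrow> real) measure" where
  "noise J = (\<Pi>\<^sub>M j\<in>J. density lborel std_normal_density)"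

definition obs_law :: "nat set \<Rightarrow> (nat \<Rightarrow> real) \<Rightarrow> (nat \<Rightarrow> real) \<Rightarrow> (nat \<Rightarrow> real) measure" where
  "obs_law J \<sigma> \<theta> =
     distr (noise J) (\<Pi>\<^sub>M j\<in>J. borel) (\<lambda>\<epsilon>. \<lambda>j\<in>J. \<theta> j + \<sigma> j * \<epsilon> j)"

definition is_test :: "nat set \<Rightarrow> ((nat \<Rightarrow> real) \<Rightarrow> real) \<Rightarrow> bool" where
  "is_test J \<Phi> \<longleftrightarrow>
     \<Phi> \<in> borel_measurable (\<Pi>\<^sub>M j\<in>J. borel) \<and>
     (\<forall>y \<in> space (\<Pi>\<^sub>M j\<in>J. (borel :: real measure)). \<Phi> y \<in> {0, 1})"

definition reject_prob ::
  "nat set \<Rightarrow> (nat \<Rightarrow> real) \<Rightarrow> ((nat \<Rightarrow> real) \<Rightarrow> real) \<Rightarrow> (nat \<Rightarrow> real) \<Rightarrow> real" where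
  "reject_prob J \<sigma> \<Phi> \<theta> =
     measure (obs_law J \<sigma> \<theta>) {y \<in> space (obs_law J \<sigma> \<theta>). \<Phi> y = 1}"

definition level_test ::
  "nat set \<Rightarrow> (nat \<Rightarrow> real) \<Rightarrow> real \<Rightarrow> ((nat \<Rightarrow> real) \<Rightarrow> real) \<Rightarrow> bool" where
  "level_test J \<sigma> \<alpha> \<Phi> \<longleftrightarrow> is_test J \<Phi> \<and> reject_prob J \<sigma> \<Phi> (\<lambda>j\<in>J. 0) \<le> \<alpha>"

text \<open>
  Infima are taken in \<open>ereal\<close>, so that the infimum of the empty set is \<open>\<infinity>\<close>. In particular
  \<open>test_rate\<close> is \<open>\<infinity>\<close> for a test that attains the power \<open>1 - \<beta>\<close> at no separation radius.
\<close>

definition worst_power ::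
  "nat set \<Rightarrow> (nat \<Rightarrow> real) \<Rightarrow> ((nat \<Rightarrow> real) \<Rightarrow> real) \<Rightarrow> (nat \<Rightarrow> real) set \<Rightarrow> real \<Rightarrow> ereal" where
  "worst_power J \<sigma> \<Phi> F \<rho> =
     (INF \<theta> \<in> {\<theta> \<in> F. l2_norm J \<theta> \<ge> \<rho>}. ereal (reject_prob J \<sigma> \<Phi> \<theta>))"

definition test_rate ::
  "nat set \<Rightarrow> (nat \<Rightarrow> real) \<Rightarrow> ((nat \<Rightarrow> real) \<Rightarrow> real) \<Rightarrow> (nat \<Rightarrow> real) set \<Rightarrow> real \<Rightarrow> ereal" where
  "test_rate J \<sigma> \<Phi> F \<beta> =
     (INF \<rho> \<in> {\<rho>. \<rho> > 0 \<and> worst_power J \<sigma> \<Phi> F \<rho> > ereal (1 - \<beta>)}. ereal \<rho>)"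

definition minimax_rate ::
  "nat set \<Rightarrow> (nat \<Rightarrow> real) \<Rightarrow> (nat \<Rightarrow> real) set \<Rightarrow> real \<Rightarrow> real \<Rightarrow> ereal" where
  "minimax_rate J \<sigma> F \<alpha> \<beta> =
     (INF \<Phi> \<in> {\<Phi>. level_test J \<sigma> \<alpha> \<Phi>}. test_rate J \<sigma> \<Phi> F \<beta>)"

definition sparse_set :: "nat set \<Rightarrow> nat \<Rightarrow> nat \<Rightarrow> (nat \<Rightarrow> real) set" where
  "sparse_set J k n =
     {\<theta> \<in> l2 J. (\<forall>j\<in>J. j > n \<longrightarrow> \<theta> j = 0) \<and> card {j \<in> {1..n}. \<theta> j \<noteq> 0} \<le> k}"

text \<open>The order statistic \<open>\<sigma>\<^bsub>(j)\<^esub>\<close> of \<open>\<sigma>\<^sub>1, \<dots>, \<sigma>\<^sub>n\<close>, for \<open>1 \<le> j \<le> n\<close>; lists are indexed from 0.\<close>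

definition ord_stat :: "(nat \<Rightarrow> real) \<Rightarrow> nat \<Rightarrow> nat \<Rightarrow> real" where
  "ord_stat \<sigma> n j = sort (map \<sigma> [1..<Suc n]) ! (j - 1)"

definition Sigma_sq :: "(nat \<Rightarrow> real) \<Rightarrow> nat \<Rightarrow> nat \<Rightarrow> nat \<Rightarrow> real" where
  "Sigma_sq \<sigma> n l k = (\<Sum>j = l + 1..l + k. (ord_stat \<sigma> n j)\<^sup>2)"

end

theory Submission
  imports Defs
begin

text \<open>
  The lower bound is Bayesian. A test of level \<open>\<alpha>\<close> that detects each signal of a finite family
  also detects a signal drawn uniformly from that family, and the law of the data is then a mixture
  with some likelihood ratio \<open>L\<close> against the pure noise. Its rejection probability exceeds the level
  by at most the total variation distance, hence by at most half of the square root of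
  \<open>E L\<^sup>2 - 1\<close> (\<open>exists_hard_alternative\<close>). Since \<open>\<alpha> + \<beta> \<le> 0.59\<close>, the test must miss some signal of the
  family as soon as \<open>E L\<^sup>2 \<le> 1 + 0.82\<^sup>2\<close>, and \<open>exp (1 / 2)\<close> lies just below this number. So everything
  rests on families in the sparse set, of norm at least \<open>\<rho>\<close>, with \<open>E L\<^sup>2 \<le> exp (1 / 2)\<close>.

  Write \<open>\<theta>\<^sub>j = \<sigma>\<^sub>j h\<^sub>j\<close>. The likelihood ratio of the shift \<open>h\<close> of the standard noise is a product of
  exponentials, and two shifts \<open>h\<close> and \<open>g\<close> correlate as \<open>exp (\<Sum>j. h\<^sub>j g\<^sub>j)\<close>; thus \<open>E L\<^sup>2\<close> is the mean
  of this exponential over two independent draws. The draws used here are \<open>h\<^sub>j = \<plusminus> a\<^sub>j\<close> on a random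
  support \<open>M\<close>, with independent fair signs. Averaging over the signs turns the exponential
  into \<open>\<Prod>j\<in>M \<inter> M'. cosh (a\<^sub>j\<^sup>2)\<close> (\<open>signed_prior_moment\<close>): only the overlap of the two supports matters.
  The radius is the maximum of several terms, and each of them has its own prior.

  For the term with index \<open>l\<close>, the support is a uniform \<open>k\<close>-subset of the \<open>n - l\<close> noisiest coordinates
  and \<open>a\<^sub>j\<^sup>2\<close> is the constant \<open>\<tau> = ln (1 + max x (sqrt x))\<close>, where \<open>x = (n - l) / k\<^sup>2\<close>. The norm is
  smallest when the support carries the \<open>k\<close> smallest available noise levels, which gives \<open>\<Sigma>\<^sub>l\<^sub>,\<^sub>k\<^sup>2 \<tau>\<close>.
  The overlap is hypergeometric and its generating function is at most that of the binomial law with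
  \<open>k\<close> trials and success probability \<open>k / (n - l)\<close> (\<open>sum_overlap_power_le\<close>); so the moment is at most
  \<open>exp ((cosh \<tau> - 1) / x)\<close>, and \<open>\<tau>\<close> is chosen so that \<open>cosh \<tau> - 1 \<le> x / 2\<close>.

  For the quartic term, the support consists of the \<open>k\<close> noisiest coordinates, and
  \<open>a\<^sub>j\<^sup>2 = \<sigma>\<^sub>j\<^sup>2 / sqrt q\<close> with \<open>q\<close> the sum of the fourth powers of their noise levels. The squared norm is
  \<open>sqrt q\<close>, and \<open>cosh y \<le> exp (y\<^sup>2 / 2)\<close> bounds the moment by \<open>exp (1 / 2)\<close>.
\<close>

section \<open>Shifting finitely many coordinates of the noise\<close>

abbreviation std_normal :: "real measure" where
  "std_normal \<equiv> density lborel std_normal_density"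

text \<open>
  The Cameron-Martin density of the standard Gaussian noise shifted by \<open>h\<close>, when \<open>h\<close> vanishes
  outside \<open>A\<close>.
\<close>

definition shift_lr :: "nat set \<Rightarrow> (nat \<Rightarrow> real) \<Rightarrow> (nat \<Rightarrow> real) \<Rightarrow> real" where
  "shift_lr A h x = (\<Prod>j\<in>A. exp (h j * x j - (h j)\<^sup>2 / 2))"

lemma prob_space_std_normal: "prob_space std_normal"
  using prob_space_normal_density[of 1 0] by simp

lemma nn_integral_std_normal_shift:
  assumes [measurable]: "f \<in> borel_measurable borel"
  shows "(\<integral>\<^sup>+x. f (h + x) \<partial>std_normal) = (\<integral>\<^sup>+x. ennreal (exp (h * x - h\<^sup>2 / 2)) * f x \<partial>std_normal)"
proof -
  let ?g = "\<lambda>x. ennreal (std_normal_density x) * (ennreal (exp (h * x - h\<^sup>2 / 2)) * f x)"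
  have tilt: "std_normal_density (h + x) * exp (h * (h + x) - h\<^sup>2 / 2) = std_normal_density x" for x
  proof -
    have "- (h + x)\<^sup>2 / 2 + (h * (h + x) - h\<^sup>2 / 2) = - x\<^sup>2 / 2"
      by (simp add: power2_eq_square field_simps)
    then show ?thesis
      unfolding std_normal_density_def mult.assoc exp_add[symmetric] by simp
  qed
  have "(\<integral>\<^sup>+x. ennreal (exp (h * x - h\<^sup>2 / 2)) * f x \<partial>std_normal) = (\<integral>\<^sup>+x. ?g x \<partial>lborel)"
    by (subst nn_integral_density) auto
  also have "\<dots> = (\<integral>\<^sup>+x. ?g (h + 1 * x) \<partial>lborel)"
    by (subst nn_integral_real_affine[where c = 1 and t = h]) auto
  also have "\<dots> = (\<integral>\<^sup>+x. ennreal (std_normal_density x) * f (h + x) \<partial>lborel)"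
    by (intro nn_integral_cong)
      (simp add: mult.assoc[symmetric] ennreal_mult[symmetric] tilt)
  also have "\<dots> = (\<integral>\<^sup>+x. f (h + x) \<partial>std_normal)"
    by (subst nn_integral_density) auto
  finally show ?thesis ..
qed

lemma emeasure_std_normal_shift:
  assumes [measurable]: "X \<in> sets borel"
  shows "(\<integral>\<^sup>+x. ennreal (exp (h * x - h\<^sup>2 / 2)) * indicator X x \<partial>std_normal)
    = emeasure std_normal ((\<lambda>x. h + x) -` X)"
proof -
  have "(\<lambda>x. h + x) -` X \<in> sets borel"
    by (rule measurable_sets_borel[where M = borel, simplified]) auto
  then have "emeasure std_normal ((\<lambda>x. h + x) -` X) = (\<integral>\<^sup>+x. indicator ((\<lambda>x. h + x) -` X) x \<partial>std_normal)"
    by simp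
  also have "\<dots> = (\<integral>\<^sup>+x. indicator X (h + x) \<partial>std_normal)"
    by (intro nn_integral_cong) (auto simp: indicator_def)
  finally show ?thesis
    by (subst nn_integral_std_normal_shift[symmetric]) auto
qed

lemma sets_noise: "sets (noise J) = sets (\<Pi>\<^sub>M j\<in>J. borel)"
  unfolding noise_def by (intro sets_PiM_cong) auto

lemma space_noise: "space (noise J) = extensional J"
  unfolding noise_def by (auto simp: space_PiM PiE_def)

lemma prob_space_noise: "prob_space (noise J)"
  unfolding noise_def by (intro prob_space_PiM prob_space_std_normal)

lemma measurable_noise_component [measurable]:
  "j \<in> J \<Longrightarrow> (\<lambda>x. x j) \<in> borel_measurable (noise J)"
  unfolding measurable_cong_sets[OF sets_noise refl] by measurable

lemma measurable_shift_lr [measurable]: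
  "A \<subseteq> J \<Longrightarrow> shift_lr A h \<in> borel_measurable (noise J)"
  unfolding shift_lr_def by (intro borel_measurable_prod) (auto intro!: measurable_compose[OF measurable_noise_component])

lemma shift_lr_pos: "shift_lr A h x > 0"
  unfolding shift_lr_def by (intro prod_pos) auto

text \<open>
  Both sides assign product values to cylinders, and the factors agree by the change of variables
  in one coordinate. As a finite measure on the product space is determined by cylinders, this
  covers infinite index sets.
\<close>

lemma noise_shift:
  assumes A: "finite A" "A \<subseteq> J" and h: "\<And>j. j \<in> J - A \<Longrightarrow> h j = 0"
  shows "distr (noise J) (\<Pi>\<^sub>M j\<in>J. borel) (\<lambda>x. \<lambda>j\<in>J. h j + x j)
    = density (noise J) (\<lambda>x. ennreal (shift_lr A h x))"
    (is "?P = ?Q")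
proof -
  let ?S = "\<lambda>_::nat. std_normal"
  interpret product_prob_space ?S J
    by (intro product_prob_spaceI prob_space_std_normal)
  have shift [measurable]: "(\<lambda>x. \<lambda>j\<in>J. h j + x j) \<in> measurable (noise J) (\<Pi>\<^sub>M j\<in>J. borel)"
    by measurable
  have [measurable]: "shift_lr A h \<in> borel_measurable (noise J)"
    using A by measurable
  show ?thesis
  proof (rule measure_eqI_PiM_infinite[where M = ?S and I = J])
    show "sets ?P = sets (PiM J ?S)" "sets ?Q = sets (PiM J ?S)"
      using sets_noise[of J] by (auto simp: noise_def)
    show "finite_measure ?P"
      using prob_space.prob_space_distr[OF prob_space_noise shift]
      by (rule prob_space.finite_measure)
    fix X B assume B: "finite B" "B \<subseteq> J" and X: "\<And>i. i \<in> B \<Longrightarrow> X i \<in> sets (?S i)"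
    \<comment> \<open>The cylinder is rewritten over a base that contains \<open>A\<close>, so that the density only
      involves coordinates of the base.\<close>
    define C where "C = B \<union> A"
    define Y where "Y i = (if i \<in> B then X i else UNIV)" for i
    have C: "finite C" "C \<subseteq> J" "A \<subseteq> C" using A B by (auto simp: C_def)
    have Y [measurable]: "Y i \<in> sets borel" for i
      using X[of i] by (auto simp: Y_def)
    let ?E = "prod_emb J ?S C (Pi\<^sub>E C Y)"
    have E: "prod_emb J ?S B (Pi\<^sub>E B X) = ?E"
      using B by (auto simp: prod_emb_def Y_def C_def PiE_iff extensional_def split: if_splits)
    have E_sets: "?E \<in> sets (noise J)"
      unfolding noise_def using C by (intro sets_PiM_I) auto
    have vim [measurable]: "(\<lambda>x. h i + x) -` Y i \<in> sets borel" for i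
      by (rule measurable_sets_borel[where M = borel, simplified]) auto
    have "emeasure ?P ?E
        = emeasure (noise J) (prod_emb J ?S C (\<Pi>\<^sub>E i\<in>C. (\<lambda>x. h i + x) -` Y i))"
    proof (subst emeasure_distr[OF shift])
      show "?E \<in> sets (\<Pi>\<^sub>M j\<in>J. borel)" using E_sets by (simp add: sets_noise)
      have "(\<lambda>x. \<lambda>j\<in>J. h j + x j) -` ?E \<inter> space (noise J)
        = prod_emb J ?S C (\<Pi>\<^sub>E i\<in>C. (\<lambda>x. h i + x) -` Y i)"
        using C by (auto simp: prod_emb_def space_noise PiE_iff extensional_def subset_iff split: if_splits)
      then show "emeasure (noise J) ((\<lambda>x. \<lambda>j\<in>J. h j + x j) -` ?E \<inter> space (noise J)) =
        emeasure (noise J) (prod_emb J ?S C (\<Pi>\<^sub>E i\<in>C. (\<lambda>x. h i + x) -` Y i))" by simp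
    qed
    also have "\<dots> = (\<Prod>i\<in>C. emeasure std_normal ((\<lambda>x. h i + x) -` Y i))"
      unfolding noise_def by (rule emeasure_PiM_emb) (use C vim in auto)
    finally have P: "emeasure ?P ?E = (\<Prod>i\<in>C. emeasure std_normal ((\<lambda>x. h i + x) -` Y i))" .
    let ?g = "\<lambda>i x. ennreal (exp (h i * x - (h i)\<^sup>2 / 2)) * indicator (Y i) x"
    have "emeasure ?Q ?E = (\<integral>\<^sup>+x. ennreal (shift_lr A h x) * indicator ?E x \<partial>noise J)"
      using E_sets by (subst emeasure_density) auto
    also have "\<dots> = (\<integral>\<^sup>+x. (\<Prod>i\<in>C. ?g i (restrict x C i)) \<partial>noise J)"
    proof (intro nn_integral_cong)
      fix x assume x: "x \<in> space (noise J)"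
      have "shift_lr A h x = (\<Prod>i\<in>C. exp (h i * x i - (h i)\<^sup>2 / 2))"
        unfolding shift_lr_def using C h by (intro prod.mono_neutral_left) auto
      moreover have "(indicator ?E x :: ennreal) = (\<Prod>i\<in>C. indicator (Y i) (x i))"
      proof (cases "\<forall>i\<in>C. x i \<in> Y i")
        case True
        then have "x \<in> ?E" using x C by (auto simp: prod_emb_def space_noise PiE_iff)
        then show ?thesis using True by simp
      next
        case False
        then have "x \<notin> ?E" by (auto simp: prod_emb_def PiE_iff)
        moreover have "(\<Prod>i\<in>C. indicator (Y i) (x i)) = (0::ennreal)"
          using False C by (auto intro!: prod_zero bexI simp: indicator_def)
        ultimately show ?thesis by simp
      qed
      ultimately show "ennreal (shift_lr A h x) * indicator ?E x = (\<Prod>i\<in>C. ?g i (restrict x C i))"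
        by (simp add: prod.distrib prod_ennreal)
    qed
    also have "\<dots> = (\<integral>\<^sup>+x. (\<Prod>i\<in>C. ?g i (x i)) \<partial>PiM C ?S)"
    proof -
      have "(\<lambda>x. ?g i (x i)) \<in> borel_measurable (PiM C ?S)" if "i \<in> C" for i
        by (rule measurable_compose[OF measurable_component_singleton[OF that]]) simp
      then have "(\<lambda>x. \<Prod>i\<in>C. ?g i (x i)) \<in> borel_measurable (PiM C ?S)"
        by (intro borel_measurable_prod_ennreal)
      then show ?thesis
        unfolding noise_def
        by (subst distr_PiM_restrict_finite[OF C(1,2), symmetric], subst nn_integral_distr)
          (auto intro!: measurable_restrict_subset C)
    qed
    also have "\<dots> = (\<Prod>i\<in>C. \<integral>\<^sup>+x. ?g i x \<partial>std_normal)"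
      using C by (intro product_nn_integral_prod) auto
    also have "\<dots> = emeasure ?P ?E"
      unfolding P by (intro prod.cong refl emeasure_std_normal_shift Y)
    finally show "emeasure ?P (prod_emb J ?S B (Pi\<^sub>E B X)) = emeasure ?Q (prod_emb J ?S B (Pi\<^sub>E B X))"
      unfolding E ..
  qed
qed

text \<open>
  Completing the square: the product of two of these densities is again one of them, up to a
  constant. With \<open>integral_shift_lr\<close> this computes all correlations without a further Gaussian integral.
\<close>

lemma shift_lr_mult:
  "shift_lr A h x * shift_lr A g x = exp (\<Sum>j\<in>A. h j * g j) * shift_lr A (\<lambda>j. h j + g j) x"
proof (cases "finite A")
  case True
  then show ?thesis
    unfolding shift_lr_def
    by (simp add: prod.distrib[symmetric] exp_sum exp_add[symmetric] power2_eq_square algebra_simps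
        add_divide_distrib diff_divide_distrib)
qed (simp add: shift_lr_def)

lemma
  assumes A: "finite A" "A \<subseteq> J"
  shows integrable_shift_lr: "integrable (noise J) (shift_lr A h)"
    and integral_shift_lr: "(\<integral>x. shift_lr A h x \<partial>noise J) = 1"
proof -
  \<comment> \<open>Only the values of \<open>h\<close> on \<open>A\<close> enter the density, but as a shift it has to vanish elsewhere.\<close>
  define g where "g j = (if j \<in> A then h j else 0)" for j
  have gh: "shift_lr A h = shift_lr A g"
    by (auto simp: shift_lr_def g_def intro!: prod.cong)
  have [measurable]: "shift_lr A g \<in> borel_measurable (noise J)"
    using A by measurable
  have "prob_space (density (noise J) (\<lambda>x. ennreal (shift_lr A g x)))"
    by (subst noise_shift[OF A, symmetric], simp add: g_def, rule prob_space.prob_space_distr[OF prob_space_noise])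
       measurable
  from prob_space.emeasure_space_1[OF this]
  have "(\<integral>\<^sup>+x. ennreal (shift_lr A g x) \<partial>noise J) = ennreal 1"
    by (subst (asm) emeasure_density) (auto cong: nn_integral_cong_simp)
  then have "has_bochner_integral (noise J) (shift_lr A g) 1"
    by (intro has_bochner_integral_nn_integral) (auto intro!: less_imp_le shift_lr_pos)
  then show "integrable (noise J) (shift_lr A h)" "(\<integral>x. shift_lr A h x \<partial>noise J) = 1"
    unfolding gh by (auto simp: has_bochner_integral_iff)
qed


section \<open>Mixtures of alternatives and second moments\<close>

text \<open>
  The rejection event pulled back to the standard noise. It is the same for every signal: a signal
  only replaces the law of the noise by a shifted one.
\<close>

definition noise_reject :: "nat set \<Rightarrow> (nat \<Rightarrow> real) \<Rightarrow> ((nat \<Rightarrow> real) \<Rightarrow> real) \<Rightarrow> (nat \<Rightarrow> real) set" where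
  "noise_reject J \<sigma> \<Phi> = {x \<in> space (noise J). \<Phi> (\<lambda>j\<in>J. \<sigma> j * x j) = 1}"

lemma noise_reject_sets:
  assumes "is_test J \<Phi>" shows "noise_reject J \<sigma> \<Phi> \<in> sets (noise J)"
proof -
  have [measurable]: "\<Phi> \<in> borel_measurable (\<Pi>\<^sub>M j\<in>J. borel)"
    using assms by (simp add: is_test_def)
  show ?thesis unfolding noise_reject_def by measurable
qed

lemma reject_prob_shift:
  assumes test: "is_test J \<Phi>" and A: "finite A" "A \<subseteq> J" and h: "\<And>j. j \<in> J - A \<Longrightarrow> h j = 0"
  shows "reject_prob J \<sigma> \<Phi> (\<lambda>j\<in>J. \<sigma> j * h j)
    = (\<integral>x. shift_lr A h x * indicator (noise_reject J \<sigma> \<Phi>) x \<partial>noise J)"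
proof -
  have [measurable]: "\<Phi> \<in> borel_measurable (\<Pi>\<^sub>M j\<in>J. borel)"
    using test by (simp add: is_test_def)
  note [measurable] = noise_reject_sets[OF test, of \<sigma>]
  let ?R = "noise_reject J \<sigma> \<Phi>" and ?s = "\<lambda>x. \<lambda>j\<in>J. h j + x j"
  have [measurable]: "shift_lr A h \<in> borel_measurable (noise J)"
    using A by measurable
  have [measurable]: "?s \<in> measurable (noise J) (\<Pi>\<^sub>M j\<in>J. borel)"
    by measurable
  have "reject_prob J \<sigma> \<Phi> (\<lambda>j\<in>J. \<sigma> j * h j)
    = measure (noise J) ((\<lambda>\<epsilon>. \<lambda>j\<in>J. (\<lambda>j\<in>J. \<sigma> j * h j) j + \<sigma> j * \<epsilon> j) -`
        {y \<in> space (\<Pi>\<^sub>M j\<in>J. borel). \<Phi> y = 1} \<inter> space (noise J))"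
    unfolding reject_prob_def obs_law_def space_distr
    by (rule measure_distr) measurable
  also have "(\<lambda>\<epsilon>. \<lambda>j\<in>J. (\<lambda>j\<in>J. \<sigma> j * h j) j + \<sigma> j * \<epsilon> j) -`
        {y \<in> space (\<Pi>\<^sub>M j\<in>J. borel). \<Phi> y = 1} \<inter> space (noise J) = ?s -` ?R \<inter> space (noise J)"
  proof -
    have "(\<lambda>j\<in>J. (\<lambda>j\<in>J. \<sigma> j * h j) j + \<sigma> j * \<epsilon> j) = (\<lambda>j\<in>J. \<sigma> j * ?s \<epsilon> j)" for \<epsilon> :: "nat \<Rightarrow> real"
      by (auto simp: algebra_simps)
    then show ?thesis
      by (auto simp: noise_reject_def space_noise space_PiM PiE_def)
  qed
  also have "measure (noise J) (?s -` ?R \<inter> space (noise J))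
    = measure (distr (noise J) (\<Pi>\<^sub>M j\<in>J. borel) ?s) ?R"
    by (rule measure_distr[symmetric]) (auto simp: sets_noise[symmetric])
  also have "\<dots> = measure (density (noise J) (\<lambda>x. ennreal (shift_lr A h x))) ?R"
    by (subst noise_shift[OF A h]) auto
  also have "\<dots> = enn2real (\<integral>\<^sup>+x. ennreal (shift_lr A h x * indicator ?R x) \<partial>noise J)"
    unfolding measure_def by (subst emeasure_density) (auto simp: ennreal_mult' shift_lr_pos less_imp_le ennreal_indicator)
  also have "\<dots> = (\<integral>x. shift_lr A h x * indicator ?R x \<partial>noise J)"
    by (rule integral_eq_nn_integral[symmetric]) (auto simp: less_imp_le shift_lr_pos)
  finally show ?thesis .
qed

text \<open>
  The gain in probability under the density \<open>L\<close> is at most the total variation distance. As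
  \<open>L - 1\<close> has mean zero, the indicator may be replaced by the indicator minus \<open>1 / 2\<close>, whose
  absolute value is \<open>1 / 2\<close>; this is where the factor \<open>1 / 2\<close> comes from.
\<close>

lemma (in prob_space) expectation_tilted_indicator_le:
  fixes L :: "'a \<Rightarrow> real"
  assumes L: "integrable M L" "expectation L = 1"
    and L2: "integrable M (\<lambda>x. (L x)\<^sup>2)" "expectation (\<lambda>x. (L x)\<^sup>2) \<le> 1 + \<delta>\<^sup>2" and \<delta>: "\<delta> > 0"
    and R [measurable]: "R \<in> events"
  shows "expectation (\<lambda>x. L x * indicator R x) \<le> prob R + \<delta> / 2"
proof -
  have int: "integrable M (\<lambda>x. L x * indicator R x)" "integrable M (\<lambda>x. indicator R x :: real)"
    using integrable_real_mult_indicator[OF R L(1)] by (auto simp: integrable_indicator_iff emeasure_eq_measure)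
  have "expectation (\<lambda>x. L x * indicator R x) - prob R
    = expectation (\<lambda>x. L x * indicator R x - indicator R x - (L x - 1) / 2)"
    using int L by (simp add: prob_space)
  also have "\<dots> \<le> expectation (\<lambda>x. ((L x)\<^sup>2 - 2 * L x + 1) / (4 * \<delta>) + \<delta> / 4)"
  proof (rule integral_mono)
    fix x
    \<comment> \<open>The left side is at most \<open>\<bar>L x - 1\<bar> / 2\<close>, and the arithmetic-geometric mean inequality
      replaces the absolute value by a square.\<close>
    have "0 \<le> (\<bar>L x - 1\<bar> - \<delta>)\<^sup>2" by simp
    then have "2 * \<bar>L x - 1\<bar> * \<delta> \<le> ((L x)\<^sup>2 - 2 * L x + 1) + \<delta>\<^sup>2"
      unfolding power2_diff power2_abs by (simp add: power2_eq_square algebra_simps)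
    then have "\<bar>L x - 1\<bar> / 2 \<le> ((L x)\<^sup>2 - 2 * L x + 1) / (4 * \<delta>) + \<delta> / 4"
      using \<delta> by (simp add: field_simps power2_eq_square)
    moreover have "L x * indicator R x - indicator R x - (L x - 1) / 2 \<le> \<bar>L x - 1\<bar> / 2"
    proof (cases "x \<in> R")
      case True
      then show ?thesis using abs_ge_self[of "L x - 1"] by (simp add: field_simps)
    next
      case False
      then show ?thesis using abs_ge_minus_self[of "L x - 1"] by (simp add: field_simps)
    qed
    ultimately show "L x * indicator R x - indicator R x - (L x - 1) / 2
      \<le> ((L x)\<^sup>2 - 2 * L x + 1) / (4 * \<delta>) + \<delta> / 4" by linarith
  qed (use int L L2 in auto)
  also have "\<dots> = (expectation (\<lambda>x. (L x)\<^sup>2) - 1) / (4 * \<delta>) + \<delta> / 4"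
    using L L2 by (simp add: prob_space)
  also have "\<dots> \<le> \<delta>\<^sup>2 / (4 * \<delta>) + \<delta> / 4"
    using L2 \<delta> by (intro add_right_mono divide_right_mono) auto
  also have "\<dots> = \<delta> / 2" using \<delta> by (simp add: power2_eq_square)
  finally show ?thesis by linarith
qed

text \<open>
  If all members of the family were detected with probability above \<open>\<alpha> + \<delta> / 2\<close>, then so would be
  their uniform mixture, against the second moment bound. The double sum in the hypothesis is the
  second moment of the likelihood ratio of the mixture before normalisation.
\<close>

lemma exists_hard_alternative:
  fixes h :: "'i \<Rightarrow> nat \<Rightarrow> real"
  assumes level: "level_test J \<sigma> \<alpha> \<Phi>" and A: "finite A" "A \<subseteq> J"
    and I: "finite I" "I \<noteq> {}" and h: "\<And>i j. i \<in> I \<Longrightarrow> j \<in> J - A \<Longrightarrow> h i j = 0"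
    and moment: "(\<Sum>i\<in>I. \<Sum>i'\<in>I. exp (\<Sum>j\<in>A. h i j * h i' j)) \<le> (1 + \<delta>\<^sup>2) * (real (card I))\<^sup>2"
    and \<delta>: "\<delta> > 0"
  shows "\<exists>i\<in>I. reject_prob J \<sigma> \<Phi> (\<lambda>j\<in>J. \<sigma> j * h i j) \<le> \<alpha> + \<delta> / 2"
proof (rule ccontr)
  assume neg: "\<not> ?thesis"
  define c where "c = real (card I)"
  have c: "c > 0" using I by (simp add: c_def card_gt_0_iff)
  interpret prob_space "noise J" by (rule prob_space_noise)
  have test: "is_test J \<Phi>" and size: "reject_prob J \<sigma> \<Phi> (\<lambda>j\<in>J. 0) \<le> \<alpha>"
    using level by (auto simp: level_test_def)
  let ?R = "noise_reject J \<sigma> \<Phi>"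
  note R [measurable] = noise_reject_sets[OF test, of \<sigma>]
  have null: "reject_prob J \<sigma> \<Phi> (\<lambda>j\<in>J. 0) = prob ?R"
    using reject_prob_shift[OF test A, of "\<lambda>_. 0" \<sigma>] by (simp add: shift_lr_def)
  define L where "L x = (\<Sum>i\<in>I. shift_lr A (h i) x) / c" for x
  have L2: "(L x)\<^sup>2 = (\<Sum>i\<in>I. \<Sum>i'\<in>I. exp (\<Sum>j\<in>A. h i j * h i' j)
      * shift_lr A (\<lambda>j. h i j + h i' j) x) / c\<^sup>2" for x
    unfolding L_def power_divide power2_eq_square[of "sum _ _"] sum_product shift_lr_mult ..
  note lr = integrable_shift_lr[OF A] integral_shift_lr[OF A]
  have "expectation (\<lambda>x. L x * indicator ?R x) \<le> prob ?R + \<delta> / 2"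
  proof (rule expectation_tilted_indicator_le[OF _ _ _ _ \<delta> R])
    show "integrable (noise J) L" "expectation L = 1"
      unfolding L_def using c by (simp_all add: lr c_def)
    show "integrable (noise J) (\<lambda>x. (L x)\<^sup>2)" unfolding L2 by (simp add: lr)
    show "expectation (\<lambda>x. (L x)\<^sup>2) \<le> 1 + \<delta>\<^sup>2"
      unfolding L2 using moment c by (simp add: lr c_def field_simps)
  qed
  moreover have "expectation (\<lambda>x. L x * indicator ?R x)
    = (\<Sum>i\<in>I. reject_prob J \<sigma> \<Phi> (\<lambda>j\<in>J. \<sigma> j * h i j)) / c"
  proof -
    have "expectation (\<lambda>x. L x * indicator ?R x)
      = expectation (\<lambda>x. (\<Sum>i\<in>I. shift_lr A (h i) x * indicator ?R x) / c)"
      by (simp add: L_def sum_distrib_right)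
    also have "\<dots> = (\<Sum>i\<in>I. expectation (\<lambda>x. shift_lr A (h i) x * indicator ?R x)) / c"
      by (simp add: lr integrable_real_mult_indicator[OF R])
    also have "\<dots> = (\<Sum>i\<in>I. reject_prob J \<sigma> \<Phi> (\<lambda>j\<in>J. \<sigma> j * h i j)) / c"
      using reject_prob_shift[OF test A h] by simp
    finally show ?thesis .
  qed
  moreover have "(\<Sum>i\<in>I. \<alpha> + \<delta> / 2) < (\<Sum>i\<in>I. reject_prob J \<sigma> \<Phi> (\<lambda>j\<in>J. \<sigma> j * h i j))"
    using neg I by (intro sum_strict_mono) (auto simp: not_le)
  ultimately have "(\<alpha> + \<delta> / 2) * c < (prob ?R + \<delta> / 2) * c"
    using pos_divide_le_eq[OF c] by (fastforce simp: c_def mult.commute)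
  then have "\<alpha> < prob ?R" using c by simp
  then show False
    using size null by simp
qed

section \<open>Moments of random signs and of random supports\<close>

text \<open>
  The signs are independent, so the sum over sign patterns factorises over coordinates. Fixing
  the second sign pattern \<open>t\<close> costs nothing because \<open>s\<^sub>j t\<^sub>j\<close> is again a fair sign.
\<close>

lemma sum_signs_exp:
  fixes b :: "'a \<Rightarrow> real"
  assumes A: "finite A" and t: "t \<in> (PiE A (\<lambda>_. {-1, 1}))"
  shows "(\<Sum>s\<in>PiE A (\<lambda>_. {-1, 1}). exp (\<Sum>j\<in>A. b j * (s j * t j))) = 2 ^ card A * (\<Prod>j\<in>A. cosh (b j))"
proof -
  have "(\<Sum>s\<in>PiE A (\<lambda>_. {-1, 1}). exp (\<Sum>j\<in>A. b j * (s j * t j)))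
    = (\<Sum>s\<in>PiE A (\<lambda>_. {-1, 1}). \<Prod>j\<in>A. exp (b j * (s j * t j)))"
    using A by (simp add: exp_sum)
  also have "\<dots> = (\<Prod>j\<in>A. \<Sum>s\<in>{-1, 1}. exp (b j * (s * t j)))"
    using A by (intro prod_sum_PiE[symmetric]) auto
  also have "\<dots> = (\<Prod>j\<in>A. 2 * cosh (b j))"
  proof (intro prod.cong refl)
    fix j assume "j \<in> A"
    then have "t j = -1 \<or> t j = 1" using t by (auto simp: PiE_iff)
    then show "(\<Sum>s\<in>{-1, 1}. exp (b j * (s * t j))) = 2 * cosh (b j)"
      by (auto simp: cosh_def)
  qed
  finally show ?thesis by (simp add: prod.distrib)
qed

text \<open>
  Drawing \<open>k\<close> of \<open>m\<close> elements without replacement hits \<open>t\<close> given elements with probability at most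
  \<open>(k / m)\<^sup>t\<close>, since each hit makes the next one less likely.
\<close>

lemma binomial_diff_le:
  assumes "t \<le> k" "k \<le> m" "0 < m"
  shows "real ((m - t) choose (k - t)) \<le> (real k / real m) ^ t * real (m choose k)"
  using assms
proof (induction t)
  case (Suc t)
  have "(k - t) * ((m - t) choose (k - t)) = (m - t) * ((m - Suc t) choose (k - Suc t))"
    using Suc.prems times_binomial_minus1_eq[of "k - t" "m - t"] by simp
  then have "real ((m - Suc t) choose (k - Suc t))
    = (real k - real t) / (real m - real t) * real ((m - t) choose (k - t))"
    using Suc.prems by (simp add: field_simps flip: of_nat_mult of_nat_diff)
  also have "\<dots> \<le> (real k / real m) * ((real k / real m) ^ t * real (m choose k))"
  proof (intro mult_mono Suc.IH)
    have "real t * real k \<le> real t * real m" using Suc.prems by (intro mult_left_mono) auto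
    then show "(real k - real t) / (real m - real t) \<le> real k / real m"
      using Suc.prems by (simp add: field_simps)
  qed (use Suc.prems in auto)
  finally show ?case by simp
qed simp

lemma card_supersets:
  assumes "finite B" "T \<subseteq> B" "card T \<le> k"
  shows "card {M. M \<subseteq> B \<and> card M = k \<and> T \<subseteq> M} = (card B - card T) choose (k - card T)"
proof -
  have fT: "finite T" using assms finite_subset by blast
  have "bij_betw (\<lambda>M. M \<union> T) {K. K \<subseteq> B - T \<and> card K = k - card T} {M. M \<subseteq> B \<and> card M = k \<and> T \<subseteq> M}"
  proof (rule bij_betw_byWitness[where f' = "\<lambda>M. M - T"])
    show "(\<lambda>M. M \<union> T) ` {K. K \<subseteq> B - T \<and> card K = k - card T} \<subseteq> {M. M \<subseteq> B \<and> card M = k \<and> T \<subseteq> M}"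
    proof safe
      fix K assume K: "K \<subseteq> B - T" "card K = k - card T"
      have "finite K" using K assms finite_subset by blast
      moreover have "K \<inter> T = {}" using K by auto
      ultimately show "card (K \<union> T) = k" using K assms fT by (simp add: card_Un_disjoint)
    qed (use assms in auto)
    show "(\<lambda>M. M - T) ` {M. M \<subseteq> B \<and> card M = k \<and> T \<subseteq> M} \<subseteq> {K. K \<subseteq> B - T \<and> card K = k - card T}"
      using fT by (auto simp: card_Diff_subset)
  qed auto
  from bij_betw_same_card[OF this] show ?thesis
    using assms fT by (simp add: n_subsets card_Diff_subset)
qed

lemma power_card_eq_sum_Pow:
  fixes c :: real
  assumes "finite M"
  shows "c ^ card M = (\<Sum>T\<in>Pow M. (c - 1) ^ card T)"
proof -
  have "(\<Sum>T\<in>Pow M. (c - 1) ^ card T) = (\<Sum>T\<in>Pow M. (\<Prod>j\<in>T. c - 1) * (\<Prod>j\<in>M - T. 1))"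
    by simp
  also have "\<dots> = (\<Prod>j\<in>M. (c - 1) + 1)"
    using assms by (rule prod_add[symmetric])
  finally show ?thesis by simp
qed

text \<open>
  This is Hoeffding's comparison of the hypergeometric law of \<open>card (M \<inter> M')\<close> with the binomial
  law. Expanding \<open>c\<^bsup>card (M \<inter> M')\<^esup>\<close> over the subsets of the overlap with the nonnegative weights
  \<open>(c - 1)\<^bsup>card T\<^esup>\<close> reduces it to the chance that \<open>M'\<close> contains a fixed set \<open>T\<close>.
\<close>

lemma sum_overlap_power_le:
  fixes c :: real
  assumes B: "finite B" and M: "M \<subseteq> B" "card M = k" and k: "0 < k" and c: "1 \<le> c"
  shows "(\<Sum>M' | M' \<subseteq> B \<and> card M' = k. c ^ card (M \<inter> M'))
    \<le> (1 + real k / real (card B) * (c - 1)) ^ k * real (card B choose k)"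
proof -
  let ?F = "{M'. M' \<subseteq> B \<and> card M' = k}" and ?r = "real k / real (card B)"
  have fM: "finite M" using B M finite_subset by blast
  have fF: "finite ?F" using B by simp
  have kB: "k \<le> card B" using M card_mono[OF B] by blast
  have "(\<Sum>M'\<in>?F. c ^ card (M \<inter> M')) = (\<Sum>M'\<in>?F. \<Sum>T\<in>Pow (M \<inter> M'). (c - 1) ^ card T)"
    using fM by (intro sum.cong refl power_card_eq_sum_Pow) auto
  also have "\<dots> = (\<Sum>M'\<in>?F. \<Sum>T\<in>Pow M. if T \<subseteq> M' then (c - 1) ^ card T else 0)"
    using fM by (intro sum.cong refl sum.mono_neutral_cong_left) auto
  also have "\<dots> = (\<Sum>T\<in>Pow M. \<Sum>M'\<in>?F. if T \<subseteq> M' then (c - 1) ^ card T else 0)"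
    by (rule sum.swap)
  also have "\<dots> = (\<Sum>T\<in>Pow M. (c - 1) ^ card T * real (card {M'. M' \<subseteq> B \<and> card M' = k \<and> T \<subseteq> M'}))"
    using fF by (intro sum.cong refl, subst sum.If_cases) (auto simp: Int_def conj_assoc)
  also have "\<dots> \<le> (\<Sum>T\<in>Pow M. (c - 1) ^ card T * (?r ^ card T * real (card B choose k)))"
  proof (intro sum_mono mult_left_mono)
    fix T assume "T \<in> Pow M"
    then have T: "T \<subseteq> B" "card T \<le> k" using M fM card_mono[OF fM] by auto
    show "real (card {M'. M' \<subseteq> B \<and> card M' = k \<and> T \<subseteq> M'}) \<le> ?r ^ card T * real (card B choose k)"
      unfolding card_supersets[OF B T] using T k kB by (intro binomial_diff_le) auto
  qed (use c in auto)
  also have "\<dots> = (\<Sum>T\<in>Pow M. ((1 + ?r * (c - 1)) - 1) ^ card T) * real (card B choose k)"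
    unfolding sum_distrib_right by (simp add: power_mult_distrib power_divide mult_ac)
  also have "\<dots> = (1 + ?r * (c - 1)) ^ k * real (card B choose k)"
    using power_card_eq_sum_Pow[OF fM] M by simp
  finally show ?thesis .
qed


section \<open>Inequalities for the hyperbolic cosine\<close>

lemma cosh_ln_one_plus: "x > -1 \<Longrightarrow> cosh (ln (1 + x)) - 1 = x\<^sup>2 / (2 * (1 + x :: real))"
  by (simp add: cosh_def exp_minus field_simps power2_eq_square)

text \<open>
  The maximum in the radius takes its form from here: by \<open>cosh_ln_one_plus\<close>, the argument
  \<open>ln (1 + y)\<close> costs about \<open>y\<^sup>2\<close> for small \<open>y\<close> and about \<open>y\<close> for large \<open>y\<close>, so a budget of order \<open>x\<close> allows
  \<open>y = sqrt x\<close> or \<open>y = x\<close>, whichever is larger.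
\<close>

lemma cosh_critical_amplitude_le:
  fixes x :: real
  assumes "0 \<le> x"
  shows "cosh (ln (1 + max x (sqrt x))) - 1 \<le> x / 2"
proof (cases "x \<le> 1")
  case True
  then have m: "max x (sqrt x) = sqrt x"
    using assms real_le_rsqrt[of x x] by (simp add: power2_eq_square mult_left_le max_def)
  have "cosh (ln (1 + sqrt x)) - 1 = x / (2 * (1 + sqrt x))"
    using assms by (subst cosh_ln_one_plus) (auto intro: less_le_trans[of _ 0])
  also have "\<dots> \<le> x / 2" using assms by (intro divide_left_mono) (auto simp: add_pos_nonneg)
  finally show ?thesis using m by simp
next
  case False
  then have "sqrt x \<le> x" by (intro real_le_lsqrt) (auto simp: power2_eq_square)
  then have m: "max x (sqrt x) = x" by simp
  have "cosh (ln (1 + x)) - 1 = x\<^sup>2 / (2 * (1 + x))"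
    using assms by (subst cosh_ln_one_plus) auto
  also have "\<dots> \<le> x / 2" using assms by (simp add: field_simps power2_eq_square)
  finally show ?thesis using m by simp
qed

text \<open>
  This is Hoeffding's lemma for a fair sign, rescaled from the variable with values 0 and 1.
\<close>

lemma cosh_le_exp_half_square: "cosh (x::real) \<le> exp (x\<^sup>2 / 2)"
proof -
  have nonneg: "cosh x \<le> exp (x\<^sup>2 / 2)" if x: "0 \<le> x" for x :: real
  proof -
    have "cosh x = exp (- x + ln (1 + 1 / 2 * (exp (2 * x) - 1)))"
    proof -
      have "(0::real) < 1 + 1 / 2 * (exp (2 * x) - 1)" using x by (simp add: add_pos_nonneg)
      then have "exp (- x + ln (1 + 1 / 2 * (exp (2 * x) - 1))) = (exp (- x) + exp (- x) * exp (2 * x)) / 2"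
        unfolding exp_add by (simp add: algebra_simps)
      also have "exp (- x) * exp (2 * x) = exp x" by (simp flip: exp_add)
      finally show ?thesis by (simp add: cosh_field_def)
    qed
    also have "\<dots> \<le> exp ((2 * x)\<^sup>2 / 8)"
      using Hoeffdings_lemma_aux[of "2 * x" "1 / 2"] x by simp
    finally show ?thesis by (simp add: power2_eq_square)
  qed
  show ?thesis
    using nonneg[of x] nonneg[of "- x"] by (cases "0 \<le> x") auto
qed

text \<open>
  The number \<open>0.82\<close> is \<open>2 * (1 - 0.59)\<close>. The elementary bound \<open>exp x \<le> 1 / (1 - x)\<close> is sharp enough
  only for small \<open>x\<close>; hence the passage to \<open>x = 1 / 32\<close>.
\<close>

lemma exp_half_le: "exp (1 / 2 :: real) \<le> 1 + 0.82\<^sup>2"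
proof -
  have "exp (1 / 2 :: real) = exp (1 / 32) ^ 16"
    by (simp flip: exp_of_nat_mult)
  also have "exp (1 / 32 :: real) \<le> 32 / 31"
    using exp_ge_add_one_self[of "- 1 / 32 :: real"] by (simp add: exp_minus field_simps)
  then have "exp (1 / 32 :: real) ^ 16 \<le> (32 / 31) ^ 16"
    by (intro power_mono) auto
  also have "\<dots> \<le> (1 + 0.82\<^sup>2 :: real)" by (simp add: power2_eq_square field_simps)
  finally show ?thesis .
qed

section \<open>Priors on sparse signals\<close>

text \<open>
  The signs are indexed by all of \<open>A\<close>, not by the support, so that supports and signs are drawn
  independently. A sign outside the support changes nothing, so one shift may have several indices;
  this is why the alternatives form an indexed family.
\<close>

lemma signed_prior_moment:
  fixes a :: "nat \<Rightarrow> real"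
  assumes A: "finite A" and F: "\<And>M. M \<in> F \<Longrightarrow> M \<subseteq> A"
  defines "h \<equiv> \<lambda>(M, s) j. if j \<in> M then a j * s j else 0"
    and "S \<equiv> PiE A (\<lambda>_. {-1, 1})"
  shows "(\<Sum>p\<in>F \<times> S. \<Sum>q\<in>F \<times> S. exp (\<Sum>j\<in>A. h p j * h q j))
    = (2 ^ card A)\<^sup>2 * (\<Sum>M\<in>F. \<Sum>M'\<in>F. \<Prod>j\<in>M \<inter> M'. cosh ((a j)\<^sup>2))"
proof -
  have cardS: "real (card S) = 2 ^ card A"
    using A by (simp add: S_def card_PiE)
  have inner: "(\<Sum>s\<in>S. exp (\<Sum>j\<in>A. h (M, t) j * h (M', s) j))
      = 2 ^ card A * (\<Prod>j\<in>M \<inter> M'. cosh ((a j)\<^sup>2))"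
    if M: "M \<in> F" "M' \<in> F" and t: "t \<in> S" for M M' t
  proof -
    define b where "b j = (if j \<in> M \<inter> M' then (a j)\<^sup>2 else 0)" for j
    have "h (M, t) j * h (M', s) j = b j * (s j * t j)" for s j
      by (simp add: h_def b_def power2_eq_square)
    then have "(\<Sum>s\<in>S. exp (\<Sum>j\<in>A. h (M, t) j * h (M', s) j)) = 2 ^ card A * (\<Prod>j\<in>A. cosh (b j))"
      using sum_signs_exp[OF A t[unfolded S_def], of b] by (simp add: S_def)
    also have "(\<Prod>j\<in>A. cosh (b j)) = (\<Prod>j\<in>M \<inter> M'. cosh ((a j)\<^sup>2))"
      using A F[OF M(1)] by (intro prod.mono_neutral_cong_right) (auto simp: b_def)
    finally show ?thesis .
  qed
  have "(\<Sum>p\<in>F \<times> S. \<Sum>q\<in>F \<times> S. exp (\<Sum>j\<in>A. h p j * h q j))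
    = (\<Sum>M\<in>F. \<Sum>t\<in>S. \<Sum>M'\<in>F. 2 ^ card A * (\<Prod>j\<in>M \<inter> M'. cosh ((a j)\<^sup>2)))"
    unfolding sum.cartesian_product' by (intro sum.cong refl inner)
  also have "\<dots> = (2 ^ card A)\<^sup>2 * (\<Sum>M\<in>F. \<Sum>M'\<in>F. \<Prod>j\<in>M \<inter> M'. cosh ((a j)\<^sup>2))"
    by (simp add: cardS sum_distrib_left[symmetric] power2_eq_square mult.assoc)
  finally show ?thesis .
qed

lemma signed_in_sparse_set:
  fixes b s :: "nat \<Rightarrow> real"
  assumes M: "M \<subseteq> {1..n}" "card M \<le> k" and J: "{1..n} \<subseteq> J" and s: "\<And>j. j \<in> M \<Longrightarrow> s j \<in> {-1, 1}"
  defines "\<theta> \<equiv> \<lambda>j\<in>J. if j \<in> M then b j * s j else 0"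
  shows "\<theta> \<in> sparse_set J k n" and "l2_norm J \<theta> = sqrt (\<Sum>j\<in>M. (b j)\<^sup>2)"
proof -
  have MJ: "M \<subseteq> J" and fM: "finite M" using M J finite_subset by auto
  have "((\<lambda>j. (\<theta> j)\<^sup>2) has_sum (\<Sum>j\<in>M. (\<theta> j)\<^sup>2)) M"
    using fM by (rule has_sum_finite)
  moreover have "(\<Sum>j\<in>M. (\<theta> j)\<^sup>2) = (\<Sum>j\<in>M. (b j)\<^sup>2)"
  proof (rule sum.cong)
    fix j assume j: "j \<in> M"
    then have "(s j)\<^sup>2 = 1" using s by fastforce
    then show "(\<theta> j)\<^sup>2 = (b j)\<^sup>2" using j MJ by (auto simp: \<theta>_def power_mult_distrib)
  qed simp
  ultimately have sum: "((\<lambda>j. (\<theta> j)\<^sup>2) has_sum (\<Sum>j\<in>M. (b j)\<^sup>2)) J"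
    using MJ by (subst has_sum_cong_neutral[where T = M]) (auto simp: \<theta>_def)
  then show "l2_norm J \<theta> = sqrt (\<Sum>j\<in>M. (b j)\<^sup>2)"
    by (simp add: l2_norm_def infsumI)
  have "card {j \<in> {1..n}. \<theta> j \<noteq> 0} \<le> card M"
    using fM J by (intro card_mono) (auto simp: \<theta>_def split: if_splits)
  then show "\<theta> \<in> sparse_set J k n"
    using sum M has_sum_imp_summable[OF sum] by (auto simp: sparse_set_def l2_def \<theta>_def)
qed

text \<open>
  The common part of both regimes: what remains to be chosen are the supports and the
  amplitudes, in units of the noise level.
\<close>

lemma sparse_prior_lower_bound:
  fixes a :: "nat \<Rightarrow> real"
  assumes level: "level_test J \<sigma> \<alpha> \<Phi>" and J: "{1..n} \<subseteq> J"
    and F: "F \<noteq> {}" "\<And>M. M \<in> F \<Longrightarrow> M \<subseteq> {1..n}" "\<And>M. M \<in> F \<Longrightarrow> card M \<le> k"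
    and far: "\<And>M. M \<in> F \<Longrightarrow> \<rho>\<^sup>2 \<le> (\<Sum>j\<in>M. (\<sigma> j * a j)\<^sup>2)"
    and overlap: "(\<Sum>M\<in>F. \<Sum>M'\<in>F. \<Prod>j\<in>M \<inter> M'. cosh ((a j)\<^sup>2)) \<le> exp (1 / 2) * (real (card F))\<^sup>2"
  shows "\<exists>\<theta>\<in>sparse_set J k n. \<rho> \<le> l2_norm J \<theta> \<and> reject_prob J \<sigma> \<Phi> \<theta> \<le> \<alpha> + 0.41"
proof -
  let ?A = "{1..n}"
  define S where "S = PiE ?A (\<lambda>_. {-1, 1 :: real})"
  define h where "h = (\<lambda>(M, s) j. if j \<in> M then a j * s j else 0)"
  have fF: "finite F" using F(2) by (intro finite_subset[of F "Pow ?A"]) auto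
  have fS: "finite S" "S \<noteq> {}" and cS: "real (card S) = 2 ^ card ?A"
    by (auto simp: S_def finite_PiE PiE_eq_empty_iff card_PiE)
  have "\<exists>p\<in>F \<times> S. reject_prob J \<sigma> \<Phi> (\<lambda>j\<in>J. \<sigma> j * h p j) \<le> \<alpha> + 0.82 / 2"
  proof (rule exists_hard_alternative[OF level _ J])
    have "(\<Sum>p\<in>F \<times> S. \<Sum>q\<in>F \<times> S. exp (\<Sum>j\<in>?A. h p j * h q j))
      = (2 ^ card ?A)\<^sup>2 * (\<Sum>M\<in>F. \<Sum>M'\<in>F. \<Prod>j\<in>M \<inter> M'. cosh ((a j)\<^sup>2))"
      unfolding h_def S_def using F by (intro signed_prior_moment) auto
    also have "\<dots> \<le> (2 ^ card ?A)\<^sup>2 * ((1 + 0.82\<^sup>2) * (real (card F))\<^sup>2)"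
      by (intro mult_left_mono order_trans[OF overlap] mult_right_mono exp_half_le) auto
    also have "\<dots> = (1 + 0.82\<^sup>2) * (real (card (F \<times> S)))\<^sup>2"
      using cS by (simp add: card_cartesian_product power_mult_distrib)
    finally show "(\<Sum>p\<in>F \<times> S. \<Sum>q\<in>F \<times> S. exp (\<Sum>j\<in>?A. h p j * h q j))
      \<le> (1 + 0.82\<^sup>2) * (real (card (F \<times> S)))\<^sup>2" .
    show "h p j = 0" if "p \<in> F \<times> S" "j \<in> J - ?A" for p j
    proof -
      have "j \<notin> fst p" using that F(2)[of "fst p"] by (auto simp: subset_iff)
      then show ?thesis by (cases p) (simp add: h_def)
    qed
  qed (use F fF fS in auto)
  then obtain M s where M: "M \<in> F" and s: "s \<in> S"
    and power: "reject_prob J \<sigma> \<Phi> (\<lambda>j\<in>J. \<sigma> j * h (M, s) j) \<le> \<alpha> + 0.41" by auto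
  have \<theta>: "(\<lambda>j\<in>J. \<sigma> j * h (M, s) j) = (\<lambda>j\<in>J. if j \<in> M then (\<sigma> j * a j) * s j else 0)"
    by (auto simp: h_def)
  have signs: "\<And>j. j \<in> M \<Longrightarrow> s j \<in> {-1, 1}"
    using s F(2)[OF M] by (auto simp: S_def PiE_iff)
  note sparse = signed_in_sparse_set[OF F(2)[OF M] F(3)[OF M] J,
      where s = s and b = "\<lambda>j. \<sigma> j * a j", OF signs]
  have "\<rho> \<le> sqrt (\<Sum>j\<in>M. (\<sigma> j * a j)\<^sup>2)"
    by (rule real_le_rsqrt[OF far[OF M]])
  then show ?thesis
    using sparse power unfolding \<theta> by (intro bexI[OF _ sparse(1)]) simp
qed


section \<open>Order statistics\<close>

lemma ord_stat_mono:
  assumes "1 \<le> i" "i \<le> j" "j \<le> n"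
  shows "ord_stat \<sigma> n i \<le> ord_stat \<sigma> n j"
  unfolding ord_stat_def using assms by (intro sorted_nth_mono) auto

text \<open>
  A sorting permutation moves from the order statistics back to the coordinates that carry them.
\<close>

lemma ord_stat_indexing:
  obtains \<pi> where "bij_betw \<pi> {1..n} {1..n}" "\<And>j. j \<in> {1..n} \<Longrightarrow> \<sigma> (\<pi> j) = ord_stat \<sigma> n j"
proof
  define xs where "xs = sort_key \<sigma> [1..<Suc n]"
  have xs: "distinct xs" "set xs = {1..n}" "length xs = n"
    by (auto simp: xs_def)
  have "sort (map \<sigma> [1..<Suc n]) = map \<sigma> xs"
    unfolding xs_def by (intro properties_for_sort) (simp_all del: upt_Suc)
  then show "\<sigma> (xs ! (j - 1)) = ord_stat \<sigma> n j" if "j \<in> {1..n}" for j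
    using that xs by (auto simp: ord_stat_def)
  have "bij_betw ((!) xs \<circ> (\<lambda>j. j - 1)) {1..n} {1..n}"
  proof (rule bij_betw_trans)
    show "bij_betw (\<lambda>j. j - 1) {1..n} {..<n}"
      by (rule bij_betw_byWitness[where f' = Suc]) auto
    show "bij_betw ((!) xs) {..<n} {1..n}"
      using xs by (intro bij_betw_nth) auto
  qed
  then show "bij_betw (\<lambda>j. xs ! (j - 1)) {1..n} {1..n}" by (simp add: o_def)
qed

text \<open>
  Exchange argument: the indices of \<open>T\<close> outside \<open>{l + 1..l + k}\<close> are as many as those of that interval
  missed by \<open>T\<close>, and the value at \<open>l + k\<close> separates the two groups.
\<close>

lemma sum_smallest_le:
  fixes f :: "nat \<Rightarrow> real"
  assumes T: "T \<subseteq> {l + 1..n}" "card T = k"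
    and f: "\<And>i j. l < i \<Longrightarrow> i \<le> j \<Longrightarrow> j \<le> n \<Longrightarrow> f i \<le> f j"
  shows "(\<Sum>j = l + 1..l + k. f j) \<le> (\<Sum>j\<in>T. f j)"
proof (cases "k = 0")
  case False
  let ?D = "{l + 1..l + k}"
  have fT: "finite T" using T finite_subset by blast
  have "k \<le> card {l + 1..n}" using T card_mono by (metis finite_atLeastAtMost)
  then have kn: "l + k \<le> n" using False by simp
  have "card (?D - T) = card ?D - card (?D \<inter> T)" "card (T - ?D) = card T - card (T \<inter> ?D)"
    using fT by (intro card_Diff_subset_Int; simp)+
  then have card: "card (?D - T) = card (T - ?D)" using T by (simp add: Int_commute)
  have "(\<Sum>j\<in>?D - T. f j) \<le> (\<Sum>j\<in>?D - T. f (l + k))"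
    using kn by (intro sum_mono f) auto
  also have "\<dots> = (\<Sum>j\<in>T - ?D. f (l + k))" by (simp only: sum_constant card)
  also have "\<dots> \<le> (\<Sum>j\<in>T - ?D. f j)"
    using T False by (intro sum_mono f) auto
  finally show ?thesis
    using sum.Int_Diff[of ?D f T] sum.Int_Diff[OF fT, of f ?D] by (simp add: Int_commute)
next
  case True
  then have "T = {}" using T finite_subset by fastforce
  then show ?thesis using True by simp
qed


section \<open>The two regimes of the radius\<close>

text \<open>
  With \<open>r = k / card B\<close> the binomial comparison gives \<open>(1 + r (c - 1))\<^sup>k\<close>, and \<open>c - 1 \<le> x / 2\<close> makes
  \<open>r (c - 1)\<close> at most \<open>1 / (2 k)\<close>.
\<close>

lemma sum_overlap_cosh_le:
  fixes B :: "nat set"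
  assumes B: "finite B" and k: "0 < k" "k \<le> card B"
  defines "x \<equiv> real (card B) / (real k)\<^sup>2"
  defines "F \<equiv> {M. M \<subseteq> B \<and> card M = k}"
  shows "(\<Sum>M\<in>F. \<Sum>M'\<in>F. \<Prod>j\<in>M \<inter> M'. cosh (ln (1 + max x (sqrt x)))) \<le> exp (1 / 2) * (real (card F))\<^sup>2"
proof -
  define c where "c = cosh (ln (1 + max x (sqrt x)))"
  define r where "r = real k / real (card B)"
  have card: "card F = card B choose k" using B by (simp add: F_def n_subsets)
  have c: "1 \<le> c" by (simp add: c_def cosh_real_ge_1)
  have "r * (c - 1) \<le> r * (x / 2)"
    unfolding c_def by (intro mult_left_mono cosh_critical_amplitude_le) (auto simp: r_def x_def)
  also have "\<dots> = 1 / (2 * real k)" using k by (auto simp: r_def x_def power2_eq_square)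
  finally have rc: "r * (c - 1) \<le> 1 / (2 * real k)" .
  have "(1 + r * (c - 1)) ^ k \<le> exp (1 / (2 * real k)) ^ k"
  proof (rule power_mono)
    show "1 + r * (c - 1) \<le> exp (1 / (2 * real k))"
      using rc exp_ge_add_one_self[of "1 / (2 * real k)"] by linarith
    show "0 \<le> 1 + r * (c - 1)" using c by (simp add: r_def)
  qed
  also have "\<dots> = exp (1 / 2)" using k by (simp flip: exp_of_nat_mult)
  finally have growth: "(1 + r * (c - 1)) ^ k \<le> exp (1 / 2)" .
  have "(\<Sum>M\<in>F. \<Sum>M'\<in>F. \<Prod>j\<in>M \<inter> M'. c) \<le> (\<Sum>M\<in>F. exp (1 / 2) * real (card F))"
  proof (rule sum_mono)
    fix M assume "M \<in> F"
    then have "(\<Sum>M'\<in>F. c ^ card (M \<inter> M')) \<le> (1 + r * (c - 1)) ^ k * real (card F)"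
      using sum_overlap_power_le[of B M k c] B k c by (simp add: card r_def) (simp add: F_def)
    also have "\<dots> \<le> exp (1 / 2) * real (card F)" using growth by (rule mult_right_mono) simp
    finally show "(\<Sum>M'\<in>F. \<Prod>j\<in>M \<inter> M'. c) \<le> exp (1 / 2) * real (card F)" by simp
  qed
  then show ?thesis by (simp add: c_def power2_eq_square mult_ac)
qed

lemma sparse_regime_lower_bound:
  assumes level: "level_test J \<sigma> \<alpha> \<Phi>" and J: "{1..n} \<subseteq> J" and \<sigma>: "\<And>j. j \<in> {1..n} \<Longrightarrow> \<sigma> j > 0"
    and kn: "1 \<le> k" "k \<le> n" and l: "l \<le> n - k"
    and \<rho>: "\<rho>\<^sup>2 = Sigma_sq \<sigma> n l k *
      ln (1 + max (real (n - l) / (real k)\<^sup>2) (sqrt (real (n - l) / (real k)\<^sup>2)))"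
  shows "\<exists>\<theta>\<in>sparse_set J k n. \<rho> \<le> l2_norm J \<theta> \<and> reject_prob J \<sigma> \<Phi> \<theta> \<le> \<alpha> + 0.41"
proof -
  obtain \<pi> where bij: "bij_betw \<pi> {1..n} {1..n}"
    and \<pi>: "\<And>j. j \<in> {1..n} \<Longrightarrow> \<sigma> (\<pi> j) = ord_stat \<sigma> n j"
    using ord_stat_indexing[of n \<sigma>] by blast
  define x where "x = real (n - l) / (real k)\<^sup>2"
  define \<tau> where "\<tau> = ln (1 + max x (sqrt x))"
  define B where "B = \<pi> ` {l + 1..n}"
  define F where "F = {M. M \<subseteq> B \<and> card M = k}"
  have \<tau>_nonneg: "0 \<le> \<tau>" by (simp add: \<tau>_def x_def max_def)
  have inj: "inj_on \<pi> {l + 1..n}"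
    using bij by (auto simp: bij_betw_def intro: inj_on_subset)
  have B: "finite B" "card B = n - l" "B \<subseteq> {1..n}"
    using inj bij by (auto simp: B_def card_image bij_betw_def)
  have kB: "k \<le> card B" using l kn B by simp
  show ?thesis
  proof (rule sparse_prior_lower_bound[OF level J, where F = F and a = "\<lambda>_. sqrt \<tau>"])
    show "F \<noteq> {}" using obtain_subset_with_card_n[OF kB] by (auto simp: F_def)
    show "M \<subseteq> {1..n}" "card M \<le> k" if "M \<in> F" for M using that B by (auto simp: F_def)
    show "(\<Sum>M\<in>F. \<Sum>M'\<in>F. \<Prod>j\<in>M \<inter> M'. cosh ((sqrt \<tau>)\<^sup>2)) \<le> exp (1 / 2) * (real (card F))\<^sup>2"
      using sum_overlap_cosh_le[OF B(1) _ kB] kn \<tau>_nonneg by (simp add: B(2) F_def \<tau>_def x_def)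
    show "\<rho>\<^sup>2 \<le> (\<Sum>j\<in>M. (\<sigma> j * sqrt \<tau>)\<^sup>2)" if "M \<in> F" for M
    proof -
      obtain T where T: "T \<subseteq> {l + 1..n}" "M = \<pi> ` T"
        using \<open>M \<in> F\<close> by (auto simp: F_def B_def subset_image_iff)
      have injT: "inj_on \<pi> T" using inj T inj_on_subset by blast
      have ord_pos: "0 < ord_stat \<sigma> n j" if "j \<in> {1..n}" for j
        using \<pi>[OF that] \<sigma>[OF bij_betwE[OF bij, rule_format, OF that]] by simp
      have "Sigma_sq \<sigma> n l k \<le> (\<Sum>j\<in>T. (ord_stat \<sigma> n j)\<^sup>2)"
        unfolding Sigma_sq_def
      proof (rule sum_smallest_le[OF T(1)])
        show "card T = k" using \<open>M \<in> F\<close> injT T by (auto simp: F_def card_image)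
        show "(ord_stat \<sigma> n i)\<^sup>2 \<le> (ord_stat \<sigma> n j)\<^sup>2" if "l < i" "i \<le> j" "j \<le> n" for i j
          using that ord_pos[of i] by (intro power_mono ord_stat_mono) (auto intro: less_imp_le)
      qed
      also have "\<dots> = (\<Sum>j\<in>M. (\<sigma> j)\<^sup>2)"
        unfolding T(2) sum.reindex[OF injT] using T \<pi> by (intro sum.cong) auto
      finally have "Sigma_sq \<sigma> n l k * \<tau> \<le> (\<Sum>j\<in>M. (\<sigma> j)\<^sup>2) * \<tau>"
        using \<tau>_nonneg by (rule mult_right_mono)
      then show ?thesis
        using \<rho> \<tau>_nonneg by (simp add: \<tau>_def[symmetric] x_def[symmetric] power_mult_distrib sum_distrib_right)
    qed
  qed
qed

text \<open>
  The support is not random here. Among squared amplitudes on it with \<open>\<Sum>a\<^sub>j\<^sup>4\<close> fixed, those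
  proportional to \<open>\<sigma>\<^sub>j\<^sup>2\<close> give the largest norm \<open>\<Sum>\<sigma>\<^sub>j\<^sup>2 a\<^sub>j\<^sup>2\<close>, by Cauchy-Schwarz.
\<close>

lemma dense_regime_lower_bound:
  assumes level: "level_test J \<sigma> \<alpha> \<Phi>" and J: "{1..n} \<subseteq> J" and \<sigma>: "\<And>j. j \<in> {1..n} \<Longrightarrow> \<sigma> j > 0"
    and kn: "1 \<le> k" "k \<le> n"
    and \<rho>: "\<rho>\<^sup>2 = sqrt (\<Sum>j = n - k + 1..n. (ord_stat \<sigma> n j) ^ 4)"
  shows "\<exists>\<theta>\<in>sparse_set J k n. \<rho> \<le> l2_norm J \<theta> \<and> reject_prob J \<sigma> \<Phi> \<theta> \<le> \<alpha> + 0.41"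
proof -
  obtain \<pi> where bij: "bij_betw \<pi> {1..n} {1..n}"
    and \<pi>: "\<And>j. j \<in> {1..n} \<Longrightarrow> \<sigma> (\<pi> j) = ord_stat \<sigma> n j"
    using ord_stat_indexing[of n \<sigma>] by blast
  define M where "M = \<pi> ` {n - k + 1..n}"
  define q where "q = (\<Sum>j\<in>M. \<sigma> j ^ 4)"
  define a where "a j = sqrt ((\<sigma> j)\<^sup>2 / sqrt q)" for j
  have inj: "inj_on \<pi> {n - k + 1..n}"
    using bij by (auto simp: bij_betw_def intro: inj_on_subset)
  have M: "finite M" "card M = k" "M \<subseteq> {1..n}"
    using inj bij kn by (auto simp: M_def card_image bij_betw_def)
  have "q > 0"
    unfolding q_def using M kn \<sigma> by (intro sum_pos zero_less_power) auto
  have \<rho>q: "\<rho>\<^sup>2 = sqrt q"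
    unfolding \<rho> q_def M_def sum.reindex[OF inj] using \<pi> by (intro arg_cong[where f = sqrt] sum.cong) auto
  have a2: "(a j)\<^sup>2 = (\<sigma> j)\<^sup>2 / sqrt q" for j
    using \<open>q > 0\<close> by (simp add: a_def)
  show ?thesis
  proof (rule sparse_prior_lower_bound[OF level J, where F = "{M}" and a = a])
    have "(\<Sum>j\<in>M. (\<sigma> j * a j)\<^sup>2) = q / sqrt q"
      by (simp add: power_mult_distrib a2 q_def sum_divide_distrib power_add[symmetric])
    also have "\<dots> = sqrt q" using \<open>q > 0\<close> by (simp add: real_div_sqrt)
    finally show "\<rho>\<^sup>2 \<le> (\<Sum>j\<in>M'. (\<sigma> j * a j)\<^sup>2)" if "M' \<in> {M}" for M'
      using that \<rho>q by simp
    have "(\<Prod>j\<in>M. cosh ((a j)\<^sup>2)) \<le> (\<Prod>j\<in>M. exp (((a j)\<^sup>2)\<^sup>2 / 2))"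
      by (intro prod_mono conjI cosh_le_exp_half_square) auto
    also have "\<dots> = exp (\<Sum>j\<in>M. \<sigma> j ^ 4 / q / 2)"
      using M \<open>q > 0\<close> by (simp add: exp_sum a2 power_divide power_mult[symmetric])
    also have "(\<Sum>j\<in>M. \<sigma> j ^ 4 / q / 2) = 1 / 2"
      using \<open>q > 0\<close> by (simp add: sum_divide_distrib[symmetric] q_def[symmetric])
    finally show "(\<Sum>K\<in>{M}. \<Sum>K'\<in>{M}. \<Prod>j\<in>K \<inter> K'. cosh ((a j)\<^sup>2)) \<le> exp (1 / 2) * (real (card {M}))\<^sup>2"
      by simp
  qed (use M in auto)
qed


section \<open>The minimax rate\<close>

text \<open>
  The worst power grows with the separation, so a test that is weak at \<open>\<rho>\<close> can only reach the
  required power beyond \<open>\<rho>\<close>.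
\<close>

lemma minimax_rate_geI:
  assumes "\<And>\<Phi>. level_test J \<sigma> \<alpha> \<Phi> \<Longrightarrow> worst_power J \<sigma> \<Phi> F \<rho> \<le> ereal (1 - \<beta>)"
  shows "ereal \<rho> \<le> minimax_rate J \<sigma> F \<alpha> \<beta>"
  unfolding minimax_rate_def test_rate_def
proof (intro INF_greatest)
  fix \<Phi> \<rho>' assume "\<Phi> \<in> {\<Phi>. level_test J \<sigma> \<alpha> \<Phi>}"
    and \<rho>': "\<rho>' \<in> {\<rho>. \<rho> > 0 \<and> worst_power J \<sigma> \<Phi> F \<rho> > ereal (1 - \<beta>)}"
  then have "worst_power J \<sigma> \<Phi> F \<rho> < worst_power J \<sigma> \<Phi> F \<rho>'"
    using assms[of \<Phi>] by (auto elim: order.strict_trans1)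
  moreover have "worst_power J \<sigma> \<Phi> F \<rho>' \<le> worst_power J \<sigma> \<Phi> F \<rho>" if "\<rho>' \<le> \<rho>"
    unfolding worst_power_def using that by (intro INF_superset_mono) auto
  ultimately show "ereal \<rho> \<le> ereal \<rho>'" by (fastforce simp: not_le)
qed

theorem theorem1:
  fixes J :: "nat set" and \<sigma> :: "nat \<Rightarrow> real" and k n :: nat and \<alpha> \<beta> \<rho> :: real
  assumes J: "(\<exists>N\<ge>1. J = {1..N} \<and> n \<le> N) \<or> J = {1..}"
    and \<sigma>_pos: "\<And>j. j \<in> J \<Longrightarrow> \<sigma> j > 0"
    and kn: "1 \<le> k" "k \<le> n"
    and \<alpha>: "0 < \<alpha>" "\<alpha> < 1"
    and \<beta>: "0 < \<beta>" "\<beta> < 1 - \<alpha>"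
    and \<alpha>\<beta>: "\<alpha> + \<beta> \<le> 0.59"
    and \<rho>_pos: "\<rho> > 0"
    and \<rho>_sq: "\<rho>\<^sup>2 =
      max (Max ((\<lambda>l. Sigma_sq \<sigma> n l k *
                 ln (1 + max (real (n - l) / (real k)\<^sup>2) (sqrt (real (n - l) / (real k)\<^sup>2))))
               ` {0..n - k}))
          (sqrt (\<Sum>j = n - k + 1..n. (ord_stat \<sigma> n j) ^ 4))"
  shows "(\<forall>\<Phi>. level_test J \<sigma> \<alpha> \<Phi> \<longrightarrow>
            (INF \<theta> \<in> {\<theta> \<in> sparse_set J k n. l2_norm J \<theta> \<ge> \<rho>}. ereal (reject_prob J \<sigma> \<Phi> \<theta>))
              \<le> ereal (1 - \<beta>))
         \<and> minimax_rate J \<sigma> (sparse_set J k n) \<alpha> \<beta> \<ge> ereal \<rho>"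
proof -
  have AJ: "{1..n} \<subseteq> J" using J by auto
  then have pos: "\<And>j. j \<in> {1..n} \<Longrightarrow> \<sigma> j > 0" using \<sigma>_pos by auto
  let ?f = "\<lambda>l. Sigma_sq \<sigma> n l k *
    ln (1 + max (real (n - l) / (real k)\<^sup>2) (sqrt (real (n - l) / (real k)\<^sup>2)))"
  have "Max (?f ` {0..n - k}) \<in> ?f ` {0..n - k}" by (intro Max_in) auto
  then obtain l where l: "l \<le> n - k" "Max (?f ` {0..n - k}) = ?f l" by (metis (no_types, lifting) atLeastAtMost_iff imageE)
  have hard: "worst_power J \<sigma> \<Phi> (sparse_set J k n) \<rho> \<le> ereal (1 - \<beta>)"
    if level: "level_test J \<sigma> \<alpha> \<Phi>" for \<Phi>
  proof -
    have "\<rho>\<^sup>2 = ?f l \<or> \<rho>\<^sup>2 = sqrt (\<Sum>j = n - k + 1..n. (ord_stat \<sigma> n j) ^ 4)"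
      using \<rho>_sq unfolding l(2) by (metis max_def)
    then obtain \<theta> where \<theta>: "\<theta> \<in> sparse_set J k n" "\<rho> \<le> l2_norm J \<theta>"
      and power: "reject_prob J \<sigma> \<Phi> \<theta> \<le> \<alpha> + 0.41"
      using sparse_regime_lower_bound[OF level AJ pos kn l(1)]
        dense_regime_lower_bound[OF level AJ pos kn] by blast
    have "worst_power J \<sigma> \<Phi> (sparse_set J k n) \<rho> \<le> ereal (reject_prob J \<sigma> \<Phi> \<theta>)"
      unfolding worst_power_def using \<theta> by (intro INF_lower) auto
    also have "\<dots> \<le> ereal (1 - \<beta>)" using power \<alpha>\<beta> by simp
    finally show ?thesis .
  qed
  then show ?thesis
    using minimax_rate_geI[of J \<sigma> \<alpha> "sparse_set J k n" \<rho> \<beta>] unfolding worst_power_def by auto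
qed

end
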